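(* Let $n\ge 2$, let $X=(x_1,\dots,x_n)$ be a vector of real numbers with $x_i\ge 0$ for $i=1,\dots,n$, and let $\alpha=(\alpha_1,\dots,\alpha_n)$ satisfy $\alpha_i>0$ for all $i$ and $\sum_{i=1}^n\alpha_i=1$. Let $\alpha_{\min}=\min_{1\le i\le n}\alpha_i$. Then $$\frac{1}{1-\alpha_{\min}}\operatorname{Var}_\alpha(X^{1/2})\le \sum_{i=1}^n\alpha_i x_i-\prod_{i=1}^n x_i^{\alpha_i}\le \frac{1}{\alpha_{\min}}\operatorname{Var}_\alpha(X^{1/2}).$$ In particular, if $\alpha=(1/n,\dots,1/n)$, then, writing $\operatorname{Var}$ for $\operatorname{Var}_\alpha$ with these equal weights, $$\frac{n}{n-1}\operatorname{Var}(X^{1/2})\le \frac1n\sum_{i=1}^n x_i-\prod_{i=1}^n x_i^{1/n}\le n\operatorname{Var}(X^{1/2}).$$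
   Context: For a vector $X=(x_1,\dots,x_n)$ with non-negative entries, $X^{1/2}:=(x_1^{1/2},\dots,x_n^{1/2})$. For positive weights $\alpha=(\alpha_1,\dots,\alpha_n)$ with $\sum_i\alpha_i=1$ and a real vector $Y=(y_1,\dots,y_n)$, $$\operatorname{Var}_\alpha(Y):=\sum_{i=1}^n\alpha_i\Bigl(y_i-\sum_{k=1}^n\alpha_k y_k\Bigr)^2=\sum_{i=1}^n\alpha_i y_i^2-\Bigl(\sum_{k=1}^n\alpha_k y_k\Bigr)^2.$$ *)

theory Defs
  imports "HOL-Analysis.Analysis"
begin

text \<open>A vector $(y_1, \dots, y_n)$ is a function of type \<^typ>\<open>nat \<Rightarrow> real\<close> of which only
  the values at indices in \<^term>\<open>{1..n}\<close> matter.\<close>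

definition wvar :: "nat \<Rightarrow> (nat \<Rightarrow> real) \<Rightarrow> (nat \<Rightarrow> real) \<Rightarrow> real" where
  "wvar n \<alpha> y = (\<Sum>i=1..n. \<alpha> i * (y i - (\<Sum>k=1..n. \<alpha> k * y k))\<^sup>2)"

lemma wvar_alt:
  assumes "(\<Sum>i=1..n. \<alpha> i) = 1"
  shows "wvar n \<alpha> y = (\<Sum>i=1..n. \<alpha> i * (y i)\<^sup>2) - (\<Sum>k=1..n. \<alpha> k * y k)\<^sup>2"
proof -
  define m where "m = (\<Sum>k=1..n. \<alpha> k * y k)"
  have "wvar n \<alpha> y = (\<Sum>i=1..n. \<alpha> i * (y i)\<^sup>2 - 2 * m * (\<alpha> i * y i) + m\<^sup>2 * \<alpha> i)"
    unfolding wvar_def m_def[symmetric]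
    by (intro sum.cong refl) (simp add: power2_eq_square algebra_simps)
  also have "\<dots> = (\<Sum>i=1..n. \<alpha> i * (y i)\<^sup>2) - 2 * m * m + m\<^sup>2 * 1"
    unfolding assms[symmetric] m_def
    by (simp only: sum.distrib sum_subtractf sum_distrib_left)
  finally show ?thesis
    by (simp add: m_def power2_eq_square)
qed

end

theory Submission
  imports Defs
begin

text \<open>With \<open>y = X\<^sup>1\<^sup>/\<^sup>2\<close>, \<open>m \<le> \<alpha>\<^sub>m\<^sub>i\<^sub>n\<close>, \<open>A = \<Sum> \<alpha>\<^sub>i y\<^sub>i\<close>, \<open>S = \<Sum> \<alpha>\<^sub>i y\<^sub>i\<^sup>2\<close> and
  \<open>P = \<Prod> y\<^sub>i\<^sup>2\<^sup>\<alpha>\<^sup>i\<close>, the two inequalities read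
  \<open>m S + (1 - m) P \<le> A\<^sup>2 \<le> (1 - m) S + m P\<close>.
  The first is the weighted AM--GM inequality for the products \<open>y\<^sub>i y\<^sub>j\<close>, with weights
  \<open>\<alpha>\<^sub>i \<alpha>\<^sub>j\<close> off the diagonal and \<open>\<alpha>\<^sub>i (\<alpha>\<^sub>i - m)\<close> on it. For the second, lower the largest
  value \<open>t\<close> of \<open>y\<close> continuously to the next largest one: the difference of the two sides has
  derivative proportional to \<open>(1 - m) t + m P / t - A\<close>, which is nonnegative by Bernoulli's
  inequality, and the difference vanishes once all values agree.\<close>

section \<open>Lower bound: weighted AM-GM over pairs of entries\<close>

lemma sum_diagonal_product:
  fixes f :: "'a \<Rightarrow> 'a \<Rightarrow> real"
  assumes "finite I"
  shows "(\<Sum>i\<in>I. \<Sum>j\<in>I. (a i * a j - (if i = j then m * a i else 0)) * f i j)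
       = (\<Sum>i\<in>I. \<Sum>j\<in>I. a i * a j * f i j) - m * (\<Sum>i\<in>I. a i * f i i)"
proof -
  have "(\<Sum>j\<in>I. (a i * a j - (if i = j then m * a i else 0)) * f i j)
      = (\<Sum>j\<in>I. a i * a j * f i j) - m * (a i * f i i)" if "i \<in> I" for i
  proof -
    have "(\<Sum>j\<in>I. (a i * a j - (if i = j then m * a i else 0)) * f i j)
       = (\<Sum>j\<in>I. a i * a j * f i j - (if i = j then m * a i * f i j else 0))"
      by (intro sum.cong refl) (auto simp: algebra_simps)
    then show ?thesis
      using assms that by (simp add: sum_subtractf mult.assoc)
  qed
  then show ?thesis
    by (simp add: sum_subtractf sum_distrib_left)
qed

text \<open>This is the case of geometric mean 1, where AM-GM reduces to averaging
  \<open>exp u \<ge> 1 + u\<close> at \<open>u = l i + l j\<close> over all pairs.\<close>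

lemma AM_GM_pairs_exp:
  fixes a l :: "'a \<Rightarrow> real"
  assumes "finite I" and m: "0 \<le> m" "\<And>i. i \<in> I \<Longrightarrow> m \<le> a i"
    and sum1: "sum a I = 1" and l0: "(\<Sum>i\<in>I. a i * l i) = 0"
  shows "m * (\<Sum>i\<in>I. a i * (exp (l i))\<^sup>2) + (1 - m) \<le> (\<Sum>i\<in>I. a i * exp (l i))\<^sup>2"
proof -
  \<comment> \<open>Taking \<open>m * a i\<close> off the diagonal leaves
    \<open>a i * (a i - m)\<close>, still nonnegative. It turns the double sum of the products into
    the squared mean minus \<open>m\<close> times the mean of squares.\<close>
  define w where "w i j = a i * a j - (if i = j then m * a i else 0)" for i j
  have w0: "0 \<le> w i j" if "i \<in> I" "j \<in> I" for i j
    using m(1) m(2)[OF that(1)] m(2)[OF that(2)]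
    by (auto simp: w_def mult_right_mono)
  have "(\<Sum>i\<in>I. \<Sum>j\<in>I. w i j * (1 + l i + l j))
      \<le> (\<Sum>i\<in>I. \<Sum>j\<in>I. w i j * (exp (l i) * exp (l j)))"
  proof (intro sum_mono mult_left_mono w0)
    fix i j
    show "1 + l i + l j \<le> exp (l i) * exp (l j)"
      using exp_ge_add_one_self[of "l i + l j"] by (simp add: exp_add add.assoc)
  qed
  also have "\<dots> = (\<Sum>i\<in>I. \<Sum>j\<in>I. a i * a j * (exp (l i) * exp (l j)))
        - m * (\<Sum>i\<in>I. a i * (exp (l i))\<^sup>2)"
    unfolding w_def sum_diagonal_product[OF \<open>finite I\<close>] by (simp add: power2_eq_square)
  also have "(\<Sum>i\<in>I. \<Sum>j\<in>I. a i * a j * (exp (l i) * exp (l j))) = (\<Sum>i\<in>I. a i * exp (l i))\<^sup>2"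
    by (simp add: power2_eq_square sum_product mult_ac)
  \<comment> \<open>The row and column sums of \<open>w\<close> are \<open>(1 - m) * a i\<close>, so
    the linear terms cancel by \<open>l0\<close> and only the total weight remains.\<close>
  also have "(\<Sum>i\<in>I. \<Sum>j\<in>I. w i j * (1 + l i + l j)) = 1 - m"
  proof -
    have "(\<Sum>i\<in>I. a i * (1 + l i + l i)) = sum a I + (\<Sum>i\<in>I. a i * l i) + (\<Sum>i\<in>I. a i * l i)"
      by (simp only: distrib_left sum.distrib mult_1_right)
    then have "(\<Sum>i\<in>I. a i * (1 + l i + l i)) = 1"
      by (simp add: sum1 l0)
    moreover have "(\<Sum>i\<in>I. \<Sum>j\<in>I. a i * a j * (1 + l i + l j)) = 1"
    proof -
      have "(\<Sum>j\<in>I. a i * a j * (1 + l i + l j)) = a i * (1 + l i)" for i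
      proof -
        have "(\<Sum>j\<in>I. a i * a j * (1 + l i + l j))
            = (\<Sum>j\<in>I. a i * (1 + l i) * a j + a i * (a j * l j))"
          by (intro sum.cong refl) (simp add: algebra_simps)
        also have "\<dots> = a i * (1 + l i) * sum a I + a i * (\<Sum>j\<in>I. a j * l j)"
          by (simp only: sum.distrib sum_distrib_left)
        finally show ?thesis by (simp add: sum1 l0)
      qed
      then show ?thesis
        using sum1 l0 by (simp add: distrib_left sum.distrib)
    qed
    ultimately show ?thesis
      unfolding w_def sum_diagonal_product[OF \<open>finite I\<close>] by simp
  qed
  finally show ?thesis by linarith
qed

text \<open>Both sides are homogeneous of degree 2 in \<open>y\<close>, so positive entries can be
  divided by their geometric mean \<open>exp L\<close>. If some entry is 0, the product vanishes and
  nonnegativity of the weights suffices.\<close>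

lemma AM_GM_pairs:
  fixes a y :: "'a \<Rightarrow> real"
  assumes "finite I" and m: "0 \<le> m" "\<And>i. i \<in> I \<Longrightarrow> m \<le> a i"
    and sum1: "sum a I = 1" and y: "\<And>i. i \<in> I \<Longrightarrow> 0 \<le> y i"
  shows "m * (\<Sum>i\<in>I. a i * (y i)\<^sup>2) + (1 - m) * (\<Prod>i\<in>I. y i powr (2 * a i))
       \<le> (\<Sum>i\<in>I. a i * y i)\<^sup>2"
proof (cases "\<exists>i\<in>I. y i = 0")
  case True
  then have P0: "(\<Prod>i\<in>I. y i powr (2 * a i)) = 0"
    using \<open>finite I\<close> by (auto intro!: prod_zero)
  have "0 \<le> (\<Sum>i\<in>I. \<Sum>j\<in>I. (a i * a j - (if i = j then m * a i else 0)) * (y i * y j))"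
  proof (intro sum_nonneg mult_nonneg_nonneg y)
    fix i j assume "i \<in> I" "j \<in> I"
    then show "0 \<le> a i * a j - (if i = j then m * a i else 0)"
      using m(1) m(2)[of i] m(2)[of j] by (auto simp: mult_right_mono)
  qed
  also have "\<dots> = (\<Sum>i\<in>I. a i * y i)\<^sup>2 - m * (\<Sum>i\<in>I. a i * (y i)\<^sup>2)"
    unfolding sum_diagonal_product[OF \<open>finite I\<close>]
    by (simp add: power2_eq_square sum_product mult_ac)
  finally show ?thesis using P0 by simp
next
  case False
  with y have pos: "0 < y i" if "i \<in> I" for i
    using that by (metis less_eq_real_def)
  define L where "L = (\<Sum>i\<in>I. a i * ln (y i))"
  define l where "l i = ln (y i) - L" for i
  have yl: "y i = exp L * exp (l i)" if "i \<in> I" for i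
    using pos[OF that] by (simp add: l_def exp_diff)
  have "(\<Sum>i\<in>I. a i * l i) = 0"
    using sum1 by (simp add: l_def right_diff_distrib sum_subtractf flip: sum_distrib_right L_def)
  then have "(exp L)\<^sup>2 * (m * (\<Sum>i\<in>I. a i * (exp (l i))\<^sup>2) + (1 - m))
      \<le> (exp L)\<^sup>2 * (\<Sum>i\<in>I. a i * exp (l i))\<^sup>2"
    using AM_GM_pairs_exp[OF \<open>finite I\<close> m sum1] by (intro mult_left_mono) auto
  moreover have "(\<Sum>i\<in>I. a i * (y i)\<^sup>2) = (exp L)\<^sup>2 * (\<Sum>i\<in>I. a i * (exp (l i))\<^sup>2)"
    by (auto simp: yl sum_distrib_left power_mult_distrib intro!: sum.cong)
  moreover have "(\<Sum>i\<in>I. a i * y i) = exp L * (\<Sum>i\<in>I. a i * exp (l i))"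
    by (auto simp: yl sum_distrib_left intro!: sum.cong)
  moreover have "(\<Prod>i\<in>I. y i powr (2 * a i)) = (exp L)\<^sup>2"
  proof -
    have "(\<Prod>i\<in>I. y i powr (2 * a i)) = (\<Prod>i\<in>I. exp (2 * (a i * ln (y i))))"
      using pos by (intro prod.cong refl) (auto simp: powr_def mult_ac dest!: pos)
    also have "\<dots> = exp (2 * L)"
      using \<open>finite I\<close> by (simp add: L_def exp_sum sum_distrib_left)
    finally show ?thesis by (simp add: exp_double)
  qed
  ultimately show ?thesis
    by (simp add: power_mult_distrib algebra_simps)
qed

section \<open>Sign of the derivative for the upper bound\<close>

lemma powr_Bernoulli_le:
  fixes v \<theta> :: real
  assumes "0 \<le> v" "v < 1" "0 \<le> \<theta>" "\<theta> \<le> 1"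
  shows "(1 - v) powr \<theta> \<le> 1 - \<theta> * v"
  using Youngs_inequality_0[of \<theta> "1 - \<theta>" "1 - v" 1] assms by (simp add: algebra_simps)

text \<open>In terms of the mean deficit \<open>D\<close>, the claim is that the product is at least
  \<open>1 - D / m\<close>. This is trivial for \<open>D \<ge> m\<close>, and \<open>D = 0\<close>
  forces all entries to be 1; otherwise Bernoulli bounds each factor by a power of
  \<open>1 - D / m\<close>.\<close>

lemma mean_le_of_le_one:
  fixes a y :: "'a \<Rightarrow> real"
  assumes "finite I" and m: "0 < m" "m \<le> 1 / 2" "\<And>i. i \<in> I \<Longrightarrow> m \<le> a i"
    and sum1: "sum a I = 1" and y: "\<And>i. i \<in> I \<Longrightarrow> 0 \<le> y i" "\<And>i. i \<in> I \<Longrightarrow> y i \<le> 1"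
  shows "(\<Sum>i\<in>I. a i * y i) \<le> (1 - m) + m * (\<Prod>i\<in>I. y i powr (2 * a i))"
proof -
  define D where "D = (\<Sum>i\<in>I. a i * (1 - y i))"
  have a0: "0 < a i" if "i \<in> I" for i
    using m(1) m(3)[OF that] by linarith
  have A: "(\<Sum>i\<in>I. a i * y i) = 1 - D"
    by (simp add: D_def right_diff_distrib sum_subtractf sum1)
  have P0: "0 \<le> (\<Prod>i\<in>I. y i powr (2 * a i))"
    by (intro prod_nonneg) auto
  have uD: "m * (1 - y i) \<le> D" if "i \<in> I" for i
  proof -
    have "m * (1 - y i) \<le> a i * (1 - y i)"
      using m(3) y(2) that by (intro mult_right_mono) auto
    also have "\<dots> \<le> D"
      unfolding D_def using \<open>finite I\<close> that y(2) a0
      by (intro member_le_sum) (auto intro!: mult_nonneg_nonneg intro: less_imp_le)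
    finally show ?thesis .
  qed
  have D0: "0 \<le> D"
    unfolding D_def using y(2) a0 by (intro sum_nonneg mult_nonneg_nonneg) (auto intro: less_imp_le)
  consider "D \<ge> m" | "D = 0" | "0 < D" "D < m"
    using D0 by linarith
  then show ?thesis
  proof cases
    case 1
    then show ?thesis using A P0 m(1) by (smt (verit) mult_nonneg_nonneg)
  next
    case 2
    have "y i = 1" if "i \<in> I" for i
      using uD[OF that] y(2)[OF that] m(1) 2 by (simp add: mult_le_0_iff)
    then have "(\<Prod>i\<in>I. y i powr (2 * a i)) = 1"
      by simp
    then show ?thesis using A 2 by simp
  next
    case 3
    define v where "v = D / m"
    have v: "0 < v" "v < 1"
      using 3 m(1) by (auto simp: v_def)
    \<comment> \<open>By \<open>uD\<close>, no deficit \<open>1 - y i\<close> exceeds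
      \<open>v\<close>. Hence \<open>\<theta> = (1 - y i) / v\<close> is admissible in Bernoulli,
      and \<open>1 - \<theta> * v\<close> is exactly \<open>y i\<close>.\<close>
    have step: "(1 - v) powr ((1 - y i) / v * (2 * a i)) \<le> y i powr (2 * a i)" if "i \<in> I" for i
    proof -
      have "(1 - y i) / v \<le> 1"
        using uD[OF that] m(1) v(1) by (simp add: v_def field_simps)
      then have "(1 - v) powr ((1 - y i) / v) \<le> y i"
        using powr_Bernoulli_le[of v "(1 - y i) / v"] v y(2)[OF that] by simp
      then have "((1 - v) powr ((1 - y i) / v)) powr (2 * a i) \<le> y i powr (2 * a i)"
        using a0[OF that] by (intro powr_mono2) auto
      then show ?thesis by (simp add: powr_powr)
    qed
    have "1 - v = (1 - v) powr 1"
      using v by simp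
    \<comment> \<open>The exponents from \<open>step\<close> add up to
      \<open>2 * D / v = 2 * m\<close>. Since \<open>m \<le> 1 / 2\<close>, this is at most 1, and a
      base below 1 gives the inequality.\<close>
    also have "\<dots> \<le> (1 - v) powr (2 * m)"
      using v m by (intro powr_mono') auto
    also have "2 * m = (\<Sum>i\<in>I. (1 - y i) / v * (2 * a i))"
    proof -
      have "(\<Sum>i\<in>I. (1 - y i) / v * (2 * a i)) = 2 / v * D"
        unfolding D_def sum_distrib_left by (intro sum.cong refl) simp
      then show ?thesis using 3 by (simp add: v_def)
    qed
    also have "(1 - v) powr \<dots> = (\<Prod>i\<in>I. (1 - v) powr ((1 - y i) / v * (2 * a i)))"
      using v by (intro powr_sum) (auto simp: \<open>finite I\<close>)
    also have "\<dots> \<le> (\<Prod>i\<in>I. y i powr (2 * a i))"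
      using step by (intro prod_mono) auto
    finally have "m * (1 - v) \<le> m * (\<Prod>i\<in>I. y i powr (2 * a i))"
      using m(1) by (intro mult_left_mono) auto
    then show ?thesis
      using A m(1) by (simp add: v_def right_diff_distrib)
  qed
qed

text \<open>Rescaling by \<open>t\<close> reduces this to entries at most 1; the product scales by
  \<open>t\<^sup>2\<close> because its exponents sum to 2.\<close>

lemma mean_times_upper_bound_le:
  fixes a y :: "'a \<Rightarrow> real"
  assumes "finite I" and m: "0 < m" "m \<le> 1 / 2" "\<And>i. i \<in> I \<Longrightarrow> m \<le> a i"
    and sum1: "sum a I = 1" and "0 < t"
    and y: "\<And>i. i \<in> I \<Longrightarrow> 0 \<le> y i" "\<And>i. i \<in> I \<Longrightarrow> y i \<le> t"
  shows "(\<Sum>i\<in>I. a i * y i) * t \<le> (1 - m) * t\<^sup>2 + m * (\<Prod>i\<in>I. y i powr (2 * a i))"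
proof -
  have "(\<Sum>i\<in>I. a i * (y i / t)) \<le> (1 - m) + m * (\<Prod>i\<in>I. (y i / t) powr (2 * a i))"
    using y \<open>0 < t\<close> by (intro mean_le_of_le_one assms) auto
  moreover have "(\<Prod>i\<in>I. (y i / t) powr (2 * a i)) = (\<Prod>i\<in>I. y i powr (2 * a i)) / t\<^sup>2"
  proof -
    have "(\<Prod>i\<in>I. t powr (2 * a i)) = t powr (\<Sum>i\<in>I. 2 * a i)"
      using \<open>0 < t\<close> \<open>finite I\<close> by (intro powr_sum[symmetric]) auto
    also have "\<dots> = t\<^sup>2"
      using \<open>0 < t\<close> sum1 by (simp flip: sum_distrib_left)
    finally have "(\<Prod>i\<in>I. t powr (2 * a i)) = t\<^sup>2" .
    moreover have "(\<Prod>i\<in>I. (y i / t) powr (2 * a i)) = (\<Prod>i\<in>I. y i powr (2 * a i) / t powr (2 * a i))"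
      using y \<open>0 < t\<close> by (intro prod.cong refl) (auto simp: powr_divide)
    ultimately show ?thesis by (simp add: prod_dividef)
  qed
  moreover have "(\<Sum>i\<in>I. a i * (y i / t)) = (\<Sum>i\<in>I. a i * y i) / t"
    by (simp add: sum_divide_distrib)
  ultimately have "(\<Sum>i\<in>I. a i * y i) / t \<le> (1 - m) + m * ((\<Prod>i\<in>I. y i powr (2 * a i)) / t\<^sup>2)"
    by simp
  from mult_right_mono[OF this, of "t\<^sup>2"] show ?thesis
    using \<open>0 < t\<close> by (simp add: distrib_right power2_eq_square)
qed

section \<open>Upper bound: merging the largest values\<close>

definition kober_gap :: "'a set \<Rightarrow> ('a \<Rightarrow> real) \<Rightarrow> real \<Rightarrow> ('a \<Rightarrow> real) \<Rightarrow> real" where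
  "kober_gap I a m y = (1 - m) * (\<Sum>i\<in>I. a i * (y i)\<^sup>2) + m * (\<Prod>i\<in>I. y i powr (2 * a i))
      - (\<Sum>i\<in>I. a i * y i)\<^sup>2"

lemma kober_gap_cong:
  "(\<And>i. i \<in> I \<Longrightarrow> y i = z i) \<Longrightarrow> kober_gap I a m y = kober_gap I a m z"
  by (simp add: kober_gap_def)

text \<open>Let the entries in \<open>J\<close> share a value \<open>t\<close> running from
  \<open>s\<close> to \<open>T\<close>. As \<open>t\<close> dominates all entries,
  \<open>mean_times_upper_bound_le\<close> makes the derivative of the gap in \<open>t\<close>
  nonnegative.\<close>

lemma kober_gap_top_mono:
  fixes a y :: "'a \<Rightarrow> real"
  assumes "finite I" and m: "0 < m" "m \<le> 1 / 2" "\<And>i. i \<in> I \<Longrightarrow> m \<le> a i"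
    and sum1: "sum a I = 1" and "J \<subseteq> I" "J \<noteq> {}" and st: "0 \<le> s" "s \<le> T"
    and y: "\<And>i. i \<in> I - J \<Longrightarrow> 0 \<le> y i" "\<And>i. i \<in> I - J \<Longrightarrow> y i \<le> s"
  shows "kober_gap I a m (\<lambda>i. if i \<in> J then s else y i)
       \<le> kober_gap I a m (\<lambda>i. if i \<in> J then T else y i)"
proof -
  have finJ: "finite J"
    using \<open>finite I\<close> \<open>J \<subseteq> I\<close> finite_subset by blast
  have a0: "0 < a i" if "i \<in> I" for i
    using m(1) m(3)[OF that] by linarith
  define z where "z t i = (if i \<in> J then t else y i)" for t i
  define W where "W = sum a J"
  define R where "R = (\<Sum>i\<in>I - J. a i * y i)"
  define R2 where "R2 = (\<Sum>i\<in>I - J. a i * (y i)\<^sup>2)"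
  define Q where "Q = (\<Prod>i\<in>I - J. y i powr (2 * a i))"
  define \<phi> where "\<phi> t = (1 - m) * (R2 + W * t\<^sup>2) + m * (Q * t powr (2 * W)) - (R + W * t)\<^sup>2" for t
  have W0: "0 < W"
    unfolding W_def using finJ \<open>J \<subseteq> I\<close> \<open>J \<noteq> {}\<close> a0 by (intro sum_pos) auto
  have A: "(\<Sum>i\<in>I. a i * z t i) = R + W * t" for t
    using sum.subset_diff[OF \<open>J \<subseteq> I\<close> \<open>finite I\<close>, of "\<lambda>i. a i * z t i"]
    by (simp add: z_def R_def W_def sum_distrib_right)
  have S: "(\<Sum>i\<in>I. a i * (z t i)\<^sup>2) = R2 + W * t\<^sup>2" for t
    using sum.subset_diff[OF \<open>J \<subseteq> I\<close> \<open>finite I\<close>, of "\<lambda>i. a i * (z t i)\<^sup>2"]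
    by (simp add: z_def R2_def W_def sum_distrib_right)
  have P: "(\<Prod>i\<in>I. z t i powr (2 * a i)) = Q * t powr (2 * W)" if "0 \<le> t" for t
  proof -
    have "(\<Prod>i\<in>J. t powr (2 * a i)) = t powr (2 * W)"
    \<comment> \<open>For \<open>t = 0\<close> both sides are 0: \<open>0 powr b\<close> is 0 for
      every \<open>b\<close>, and \<open>J\<close> is nonempty.\<close>
    proof (cases "t = 0")
      case True
      then show ?thesis using finJ \<open>J \<noteq> {}\<close> by (simp add: card_gt_0_iff)
    next
      case False
      then show ?thesis
        using finJ by (simp add: W_def sum_distrib_left powr_sum)
    qed
    then show ?thesis
      using prod.subset_diff[OF \<open>J \<subseteq> I\<close> \<open>finite I\<close>, of "\<lambda>i. z t i powr (2 * a i)"]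
      by (simp add: z_def Q_def)
  qed
  have gap: "kober_gap I a m (z t) = \<phi> t" if "0 \<le> t" for t
    unfolding kober_gap_def \<phi>_def A S P[OF that] ..
  \<comment> \<open>Derivatives are taken only inside the interval: \<open>s\<close> may be 0, where
    \<open>t powr (2 * W)\<close> need not be differentiable but is continuous because
    \<open>W > 0\<close>.\<close>
  have "\<phi> s \<le> \<phi> T"
  proof (rule DERIV_nonneg_imp_increasing_open[OF st(2)])
    fix t assume t: "s < t" "t < T"
    with st have t0: "0 < t" by linarith
    define d where "d = (1 - m) * (W * (2 * t)) + m * (Q * (2 * W * t powr (2 * W - 1)))
        - 2 * (R + W * t) * W"
    have "(\<phi> has_real_derivative d) (at t)"
      unfolding \<phi>_def d_def by (rule derivative_eq_intros refl t0 | simp add: t0)+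
    moreover have "0 \<le> d"
    proof -
      have "(\<Sum>i\<in>I. a i * z t i) * t \<le> (1 - m) * t\<^sup>2 + m * (\<Prod>i\<in>I. z t i powr (2 * a i))"
        using m y t t0 by (intro mean_times_upper_bound_le \<open>finite I\<close> sum1)
          (auto simp: z_def intro: order_trans[of _ s] less_imp_le)
      then have "0 \<le> 2 * W * ((1 - m) * t\<^sup>2 + m * (Q * t powr (2 * W)) - (R + W * t) * t)"
        using W0 t0 by (simp add: A P)
      \<comment> \<open>The factor \<open>t\<close> restores the exponent \<open>2 * W\<close> from
        \<open>2 * W - 1\<close>, so that the product of all entries reappears.\<close>
      also have "\<dots> = d * t"
        using t0 by (simp add: d_def powr_diff field_simps power2_eq_square)
      finally show ?thesis using t0 by (simp add: zero_le_mult_iff)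
    qed
    ultimately show "\<exists>d. (\<phi> has_real_derivative d) (at t) \<and> d \<ge> 0" by blast
  next
    show "continuous_on {s..T} \<phi>"
      unfolding \<phi>_def using W0 st
      by (intro continuous_intros continuous_on_powr') auto
  qed
  with gap[of s] gap[of T] st show ?thesis
    by (simp add: z_def[abs_def])
qed

text \<open>Induction on the number of distinct values: lowering all maximal entries to the second
  largest value removes one value and does not increase the gap. A constant vector has gap
  0.\<close>

lemma kober_gap_nonneg:
  fixes a y :: "'a \<Rightarrow> real"
  assumes "finite I" and m: "0 < m" "m \<le> 1 / 2" "\<And>i. i \<in> I \<Longrightarrow> m \<le> a i"
    and sum1: "sum a I = 1" and "\<And>i. i \<in> I \<Longrightarrow> 0 \<le> y i"
  shows "0 \<le> kober_gap I a m y"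
  using assms(6)
proof (induction "card (y ` I)" arbitrary: y rule: less_induct)
  case less
  have "I \<noteq> {}" using sum1 by auto
  define T where "T = Max (y ` I)"
  have T: "T \<in> y ` I" "\<And>i. i \<in> I \<Longrightarrow> y i \<le> T"
    using \<open>finite I\<close> \<open>I \<noteq> {}\<close> by (auto simp: T_def intro!: Max_in)
  have T0: "0 \<le> T" using T(1) less.prems by auto
  show ?case
  proof (cases "y ` I = {T}")
    case True
    then have "kober_gap I a m y = kober_gap I a m (\<lambda>_. T)"
      by (intro kober_gap_cong) auto
    also have "\<dots> = 0"
    proof (cases "T = 0")
      case True
      then show ?thesis
        using \<open>finite I\<close> \<open>I \<noteq> {}\<close> by (simp add: kober_gap_def card_gt_0_iff)
    next
      case False
      have "(\<Prod>i\<in>I. T powr (2 * a i)) = T\<^sup>2"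
        using False T0 \<open>finite I\<close> sum1 by (simp flip: powr_sum sum_distrib_left)
      then show ?thesis
        by (simp add: kober_gap_def sum1 left_diff_distrib flip: sum_distrib_right)
    qed
    finally show ?thesis by simp
  next
    case False
    define s where "s = Max (y ` I - {T})"
    have ne: "y ` I - {T} \<noteq> {}" using False T(1) by auto
    have "s \<in> y ` I - {T}"
      unfolding s_def using \<open>finite I\<close> ne by (intro Max_in) auto
    then have s: "s \<in> y ` I" "s \<noteq> T" by auto
    have s0: "0 \<le> s" "s \<le> T"
      using s T(2) less.prems by auto
    have le_s: "y i \<le> s" if "i \<in> I" "y i \<noteq> T" for i
      unfolding s_def using \<open>finite I\<close> that by (intro Max_ge) auto
    define J where "J = {i \<in> I. y i = T}"
    define z where "z i = (if i \<in> J then s else y i)" for i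
    have "z ` I \<subseteq> y ` I - {T}"
      using s by (auto simp: z_def J_def)
    then have "card (z ` I) < card (y ` I)"
      using \<open>finite I\<close> T(1) by (intro psubset_card_mono) auto
    then have "0 \<le> kober_gap I a m z"
      using less.prems s0 by (intro less.hyps) (auto simp: z_def)
    also have "\<dots> \<le> kober_gap I a m (\<lambda>i. if i \<in> J then T else y i)"
      unfolding z_def
      using m T(1) s0 less.prems le_s \<open>finite I\<close> sum1
      by (intro kober_gap_top_mono) (auto simp: J_def)
    also have "\<dots> = kober_gap I a m y"
      by (intro kober_gap_cong) (auto simp: J_def)
    finally show ?thesis .
  qed
qed

section \<open>Return to variances and the two forms of the theorem\<close>

lemma AM_GM_variance_bounds:
  \<comment> \<open>Any positive lower bound \<open>m\<close> of the weights is allowed, so that the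
    minimum and \<open>1 / real n\<close> are both instances.\<close>
  fixes n :: nat and x \<alpha> :: "nat \<Rightarrow> real" and m :: real
  assumes "n \<ge> 2" and x: "\<And>i. i \<in> {1..n} \<Longrightarrow> x i \<ge> 0"
    and m: "0 < m" "\<And>i. i \<in> {1..n} \<Longrightarrow> m \<le> \<alpha> i" and sum1: "(\<Sum>i=1..n. \<alpha> i) = 1"
  shows "1 / (1 - m) * wvar n \<alpha> (\<lambda>i. sqrt (x i))
           \<le> (\<Sum>i=1..n. \<alpha> i * x i) - (\<Prod>i=1..n. x i powr \<alpha> i)" (is ?lower)
    and "(\<Sum>i=1..n. \<alpha> i * x i) - (\<Prod>i=1..n. x i powr \<alpha> i)
           \<le> 1 / m * wvar n \<alpha> (\<lambda>i. sqrt (x i))" (is ?upper)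
proof -
  \<comment> \<open>With at least two weights, each at least \<open>m\<close> and of total 1,
    \<open>m\<close> is at most 1/2.\<close>
  have "2 * m \<le> real n * m"
    using \<open>n \<ge> 2\<close> m(1) by (intro mult_right_mono) auto
  also have "\<dots> = (\<Sum>i=1..n. m)" by simp
  also have "\<dots> \<le> (\<Sum>i=1..n. \<alpha> i)" using m(2) by (intro sum_mono) auto
  finally have m2: "m \<le> 1 / 2" using sum1 by simp
  define y where "y i = sqrt (x i)" for i
  have y0: "0 \<le> y i" if "i \<in> {1..n}" for i
    using x[OF that] by (simp add: y_def)
  have S: "(\<Sum>i=1..n. \<alpha> i * x i) = (\<Sum>i=1..n. \<alpha> i * (y i)\<^sup>2)"
    using x by (intro sum.cong refl) (simp add: y_def)
  have P: "(\<Prod>i=1..n. x i powr \<alpha> i) = (\<Prod>i=1..n. y i powr (2 * \<alpha> i))"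
    using x by (intro prod.cong refl) (simp add: y_def powr_powr flip: powr_half_sqrt)
  have V: "wvar n \<alpha> (\<lambda>i. sqrt (x i)) = (\<Sum>i=1..n. \<alpha> i * (y i)\<^sup>2) - (\<Sum>i=1..n. \<alpha> i * y i)\<^sup>2"
    unfolding y_def by (rule wvar_alt[OF sum1])
  have "m * (\<Sum>i=1..n. \<alpha> i * (y i)\<^sup>2) + (1 - m) * (\<Prod>i=1..n. y i powr (2 * \<alpha> i))
       \<le> (\<Sum>i=1..n. \<alpha> i * y i)\<^sup>2"
    using m y0 by (intro AM_GM_pairs sum1) auto
  \<comment> \<open>Clearing the denominator \<open>1 - m > 0\<close> gives the pair inequality;
    below, multiplying by \<open>m\<close> gives nonnegativity of the gap.\<close>
  then show ?lower
    unfolding S P V using m2 by (simp add: field_simps)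
  have "0 \<le> kober_gap {1..n} \<alpha> m y"
    using m m2 y0 by (intro kober_gap_nonneg sum1) auto
  then show ?upper
    unfolding S P V kober_gap_def using m(1) by (simp add: field_simps)
qed

theorem theorem2p2:
  fixes n :: nat and x :: "nat \<Rightarrow> real"
  assumes "n \<ge> 2"
    and "\<And>i. i \<in> {1..n} \<Longrightarrow> x i \<ge> 0"
  shows "(\<forall>\<alpha> :: nat \<Rightarrow> real.
            (\<forall>i\<in>{1..n}. \<alpha> i > 0) \<and> (\<Sum>i=1..n. \<alpha> i) = 1 \<longrightarrow>
            (let \<alpha>min = Min (\<alpha> ` {1..n}) in
               1 / (1 - \<alpha>min) * wvar n \<alpha> (\<lambda>i. sqrt (x i))
                 \<le> (\<Sum>i=1..n. \<alpha> i * x i) - (\<Prod>i=1..n. x i powr \<alpha> i) \<and>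
               (\<Sum>i=1..n. \<alpha> i * x i) - (\<Prod>i=1..n. x i powr \<alpha> i)
                 \<le> 1 / \<alpha>min * wvar n \<alpha> (\<lambda>i. sqrt (x i))))
       \<and> (real n / (real n - 1) * wvar n (\<lambda>_. 1 / real n) (\<lambda>i. sqrt (x i))
             \<le> 1 / real n * (\<Sum>i=1..n. x i) - (\<Prod>i=1..n. x i powr (1 / real n)) \<and>
          1 / real n * (\<Sum>i=1..n. x i) - (\<Prod>i=1..n. x i powr (1 / real n))
             \<le> real n * wvar n (\<lambda>_. 1 / real n) (\<lambda>i. sqrt (x i)))"
proof (intro conjI allI impI)
  fix \<alpha> :: "nat \<Rightarrow> real"
  assume \<alpha>: "(\<forall>i\<in>{1..n}. \<alpha> i > 0) \<and> (\<Sum>i=1..n. \<alpha> i) = 1"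
  have "0 < Min (\<alpha> ` {1..n})"
    using \<alpha> \<open>n \<ge> 2\<close> by (subst Min_gr_iff) auto
  moreover have "Min (\<alpha> ` {1..n}) \<le> \<alpha> i" if "i \<in> {1..n}" for i
    using that by (intro Min_le) auto
  ultimately show "let \<alpha>min = Min (\<alpha> ` {1..n}) in
               1 / (1 - \<alpha>min) * wvar n \<alpha> (\<lambda>i. sqrt (x i))
                 \<le> (\<Sum>i=1..n. \<alpha> i * x i) - (\<Prod>i=1..n. x i powr \<alpha> i) \<and>
               (\<Sum>i=1..n. \<alpha> i * x i) - (\<Prod>i=1..n. x i powr \<alpha> i)
                 \<le> 1 / \<alpha>min * wvar n \<alpha> (\<lambda>i. sqrt (x i))"
    unfolding Let_def using \<alpha> by (intro conjI AM_GM_variance_bounds assms) auto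
next
  note bounds = AM_GM_variance_bounds[where m = "1 / real n" and \<alpha> = "\<lambda>_. 1 / real n" and x = x, OF assms]
  have "1 / (1 - 1 / real n) = real n / (real n - 1)"
    using \<open>n \<ge> 2\<close> by (simp add: field_simps)
  then show "real n / (real n - 1) * wvar n (\<lambda>_. 1 / real n) (\<lambda>i. sqrt (x i))
             \<le> 1 / real n * (\<Sum>i=1..n. x i) - (\<Prod>i=1..n. x i powr (1 / real n))"
    using bounds(1) \<open>n \<ge> 2\<close> unfolding sum_distrib_left by simp
  show "1 / real n * (\<Sum>i=1..n. x i) - (\<Prod>i=1..n. x i powr (1 / real n))
             \<le> real n * wvar n (\<lambda>_. 1 / real n) (\<lambda>i. sqrt (x i))"
    using bounds(2) \<open>n \<ge> 2\<close> unfolding sum_distrib_left by simp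
qed

end
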